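(* Let $\mathcal J$ be an ideal on $\omega$. (1) The following conditions are equivalent: (a) $\mathcal J$ is extendable to a selective ideal (i.e. $\mathcal J\subseteq\mathcal J'$ for some selective ideal $\mathcal J'$ on $\omega$); (b) $\mathcal{ED}\not\preceq^{\omega_1}_{\omega^\omega,1-1}\mathcal J$; (c) $\mathcal{ED}\not\preceq^{\omega_1}_{\omega^\omega,\mathrm{Fin}-1}\mathcal J$; (d) $\mathcal{ED}\not\preceq^{\omega_1}_{\omega^\omega,\omega^\omega}\mathcal J$. (2) Under CH, the conditions (a), (b), (c), (d) listed in (1) are equivalent to each of the following: (e) there is a selective ultrafilter which is not a $\mathcal J$-point; (f) there is a selective ultrafilter which is not a weak $\mathcal J$-ultrafilter; (g) there is a selective ultrafilter which is not a $\mathcal J$-ultrafilter.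
   Context: An ideal on a set $X$ is a family of subsets of $X$ closed under finite unions and subsets, containing all finite subsets of $X$ and not containing $X$; $\mathcal J^+=\mathcal P(X)\setminus\mathcal J$. Ideals on countably infinite sets are regarded as ideals on $\omega$ via fixed bijections. $\mathcal{ED}=\{A\subseteq\omega\times\omega:\exists m$ such that for all but finitely many $n$, $|\{k:(n,k)\in A\}|<m\}$. $\mathcal J$ is a selective ideal if for every decreasing sequence $(A_n)_{n\in\omega}$ of sets in $\mathcal J^+$ there is $A\in\mathcal J^+$, $A\subseteq A_0$, such that $|A\cap(A_n\setminus A_{n+1})|\le1$ for every $n$. For $\mathcal F\subseteq\omega^\omega$ and ideals $\mathcal I,\mathcal K$ on $\omega$, $\mathcal I\le_{\mathcal F}\mathcal K$ means that there is $f\in\mathcal F$ with $f^{-1}[B]\in\mathcal K$ for every $B\in\mathcal I$. $\mathrm{Fin}-1$ and $1-1$ denote the families of all finite-to-one, respectively one-to-one, functions $\omega\to\omega$. For an ideal $\mathcal K$ on $\omega$ and $\mathcal A\subseteq\mathcal P(\omega)$, $\mathcal K(\mathcal A)=\{B\subseteq\omega:\exists F\in[\mathcal A]^{<\omega}\ (B\setminus\bigcup F\in\mathcal K)\}$. $\mathcal I\preceq^{\omega_1}_{\mathcal F,\mathcal G}\mathcal J$ means: for each ideal $\mathcal J'$ on $\omega$ with $\mathcal J\le_{\mathcal G}\mathcal J'$ there is a countable $\mathcal A\subseteq\mathcal P(\omega)$ with $\omega\notin\mathcal J'(\mathcal A)$ and $\mathcal I\le_{\mathcal F}\mathcal J'(\mathcal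 A)$. Ultrafilters on $\omega$ contain all cofinite sets; $\mathcal U^*=\{\omega\setminus A:A\in\mathcal U\}$. $\mathcal U$ is a selective (Ramsey) ultrafilter if $\mathcal U^*$ is a selective ideal. $\mathcal U$ is a $\mathcal J$-ultrafilter (weak $\mathcal J$-ultrafilter, $\mathcal J$-point) if $\mathcal J\not\le_{\mathcal F}\mathcal U^*$ for $\mathcal F=\omega^\omega$ ($\mathrm{Fin}-1$, $1-1$, respectively). *)

theory Defs
  imports Complex_Main "HOL-Library.Countable_Set" "HOL-Library.Nat_Bijection"
begin

text \<open>Ideals on a set are modelled as ideals on the universe of a type; \<open>\<omega>\<close> is \<^typ>\<open>nat\<close>.
  Closure under finite unions reduces to binary unions, since the empty set is finite.\<close>

definition is_ideal :: "'a set set \<Rightarrow> bool" where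
  "is_ideal J \<longleftrightarrow>
     (\<forall>A\<in>J. \<forall>B\<in>J. A \<union> B \<in> J) \<and>
     (\<forall>A\<in>J. \<forall>B. B \<subseteq> A \<longrightarrow> B \<in> J) \<and>
     (\<forall>A. finite A \<longrightarrow> A \<in> J) \<and>
     UNIV \<notin> J"

definition positive :: "'a set set \<Rightarrow> 'a set set" where
  "positive J = UNIV - J"

definition ED_prod :: "(nat \<times> nat) set set" where
  "ED_prod = {A. \<exists>m. \<forall>\<^sub>F n in cofinite. finite {k. (n, k) \<in> A} \<and> card {k. (n, k) \<in> A} < m}"

text \<open>\<open>\<E>\<D>\<close> as an ideal on \<open>\<omega>\<close>, transported along the fixed bijection
  \<^const>\<open>prod_encode\<close> from \<open>\<omega> \<times> \<omega>\<close> to \<open>\<omega>\<close>.\<close>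

definition ED :: "nat set set" where
  "ED = {prod_encode ` A | A. A \<in> ED_prod}"

definition selective_ideal :: "nat set set \<Rightarrow> bool" where
  "selective_ideal J \<longleftrightarrow> is_ideal J \<and>
     (\<forall>A :: nat \<Rightarrow> nat set. decseq A \<and> (\<forall>n. A n \<in> positive J) \<longrightarrow>
        (\<exists>B\<in>positive J. B \<subseteq> A 0 \<and>
           (\<forall>n. finite (B \<inter> (A n - A (Suc n))) \<and> card (B \<inter> (A n - A (Suc n))) \<le> 1)))"

definition extendable_to_selective :: "nat set set \<Rightarrow> bool" where
  "extendable_to_selective J \<longleftrightarrow> (\<exists>J'. selective_ideal J' \<and> J \<subseteq> J')"

definition all_functions :: "(nat \<Rightarrow> nat) set" where
  "all_functions = UNIV"

definition finite_to_one :: "(nat \<Rightarrow> nat) set" where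
  "finite_to_one = {f. \<forall>n. finite (f -` {n})}"

definition one_to_one :: "(nat \<Rightarrow> nat) set" where
  "one_to_one = {f. inj f}"

text \<open>\<open>le_via \<F> \<I> \<K>\<close> is \<open>\<I> \<le>\<^sub>\<F> \<K>\<close>. The second family is not required to be an ideal,
  as the relation is also applied to \<open>\<K>(\<A>)\<close>.\<close>

definition le_via :: "(nat \<Rightarrow> nat) set \<Rightarrow> nat set set \<Rightarrow> nat set set \<Rightarrow> bool" where
  "le_via F I K \<longleftrightarrow> (\<exists>f\<in>F. \<forall>B\<in>I. f -` B \<in> K)"

text \<open>\<open>extend_by \<K> \<A>\<close> is \<open>\<K>(\<A>)\<close>.\<close>

definition extend_by :: "nat set set \<Rightarrow> nat set set \<Rightarrow> nat set set" where
  "extend_by K \<A> = {B. \<exists>F. finite F \<and> F \<subseteq> \<A> \<and> B - \<Union>F \<in> K}"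

text \<open>\<open>preceq_omega1 \<F> \<G> \<I> \<J>\<close> is \<open>\<I> \<preceq> \<J>\<close> with superscript \<open>\<omega>\<^sub>1\<close> and subscripts \<open>\<F>, \<G>\<close>.\<close>

definition preceq_omega1 ::
  "(nat \<Rightarrow> nat) set \<Rightarrow> (nat \<Rightarrow> nat) set \<Rightarrow> nat set set \<Rightarrow> nat set set \<Rightarrow> bool" where
  "preceq_omega1 F G I J \<longleftrightarrow>
     (\<forall>J'. is_ideal J' \<and> le_via G J J' \<longrightarrow>
        (\<exists>\<A>. countable \<A> \<and> UNIV \<notin> extend_by J' \<A> \<and> le_via F I (extend_by J' \<A>)))"

definition is_ultrafilter :: "nat set set \<Rightarrow> bool" where
  "is_ultrafilter U \<longleftrightarrow>
     (\<forall>A\<in>U. \<forall>B\<in>U. A \<inter> B \<in> U) \<and>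
     (\<forall>A\<in>U. \<forall>B. A \<subseteq> B \<longrightarrow> B \<in> U) \<and>
     (\<forall>A. finite (- A) \<longrightarrow> A \<in> U) \<and>
     {} \<notin> U \<and>
     (\<forall>A. A \<in> U \<or> - A \<in> U)"

definition dual_ideal :: "nat set set \<Rightarrow> nat set set" where
  "dual_ideal U = {- A | A. A \<in> U}"

definition selective_ultrafilter :: "nat set set \<Rightarrow> bool" where
  "selective_ultrafilter U \<longleftrightarrow> is_ultrafilter U \<and> selective_ideal (dual_ideal U)"

definition J_ultrafilter :: "nat set set \<Rightarrow> nat set set \<Rightarrow> bool" where
  "J_ultrafilter J U \<longleftrightarrow> is_ultrafilter U \<and> \<not> le_via all_functions J (dual_ideal U)"

definition weak_J_ultrafilter :: "nat set set \<Rightarrow> nat set set \<Rightarrow> bool" where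
  "weak_J_ultrafilter J U \<longleftrightarrow> is_ultrafilter U \<and> \<not> le_via finite_to_one J (dual_ideal U)"

definition J_point :: "nat set set \<Rightarrow> nat set set \<Rightarrow> bool" where
  "J_point J U \<longleftrightarrow> is_ultrafilter U \<and> \<not> le_via one_to_one J (dual_ideal U)"

text \<open>The cardinality of the power set of \<open>\<omega>\<close> is the cardinal successor of \<open>\<aleph>\<^sub>0\<close>.\<close>

definition CH :: bool where
  "CH \<longleftrightarrow> (card_of (UNIV :: nat set set), cardSuc natLeq) \<in> ordIso"

end

theory Submission
  imports Defs "HOL-Library.Countable_Set_Type"
begin

text \<open>
  The key observation is that the relation \<open>\<E>\<D> \<preceq>\<close> only serves to express selectivity: an ideal
  \<open>J'\<close> is selective iff \<open>\<E>\<D> \<not>\<le> J'(\<A>)\<close> for every countable \<open>\<A>\<close> with \<open>\<omega> \<notin> J'(\<A>)\<close>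
  (\<open>selective_ideal_iff_not_ED_le\<close>).  This rests on a combinatorial reformulation: for a family
  \<open>L\<close> closed under subsets and unions, \<open>\<E>\<D> \<le> L\<close> says that some \<open>\<phi> : \<omega> \<rightarrow> \<omega>\<close> has all its
  fibres, and all sets on which it is injective, in \<open>L\<close> (\<open>ED_le_iff\<close>).  If \<open>J'\<close> is selective,
  a positive set almost disjoint from all members of \<open>\<A>\<close> and from all fibres of \<open>\<phi>\<close> can be
  thinned out to one on which \<open>\<phi>\<close> is injective, so \<open>\<phi>\<close> is no such function.  Conversely, let
  \<open>D\<close> be a decreasing sequence of positive sets.  If its intersection is positive, the
  intersection is as required.  Otherwise take \<open>\<A> = {\<omega> \<setminus> D n | n}\<close>: a function that is constantly
  \<open>n\<close> on \<open>D n \<setminus> D (n + 1)\<close> is injective on some set outside \<open>J'(\<A>)\<close>, whose intersection with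
  \<open>D 0\<close> is as required.

  Hence each of (b), (c), (d) says that \<open>J \<le> J'\<close> for some selective \<open>J'\<close>, via a function of the
  respective kind.  If \<open>f\<close> witnesses this, its fibres lie in \<open>J'\<close>, so \<open>f\<close> is injective on a
  positive set \<open>B\<close>, and the image of \<open>J'\<close> restricted to \<open>B\<close> is a selective ideal that
  contains \<open>J\<close> (\<open>extendable_if_le_selective\<close>).  The same lemma, applied to the dual ideal of an
  ultrafilter, derives (a) from (g).

  Under CH, a selective ideal \<open>K\<close> is contained in the dual of a selective ultrafilter
  (\<open>CH_selective_ultrafilter\<close>): well-order \<open>\<omega>\<^sup>\<omega>\<close> so that all proper initial segments are countable
  and choose recursively, along this order, \<open>K\<close>-positive sets that decrease modulo finite sets,
  the set at stage \<open>f\<close> being one on which \<open>f\<close> is constant or injective.  Selectivity of \<open>K\<close>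
  carries the recursion through countable stages, and the chosen sets generate the ultrafilter.
\<close>

section \<open>Ideals\<close>

lemma ideal_Un: "is_ideal J \<Longrightarrow> A \<in> J \<Longrightarrow> B \<in> J \<Longrightarrow> A \<union> B \<in> J"
  by (simp add: is_ideal_def)

lemma ideal_subset: "is_ideal J \<Longrightarrow> A \<in> J \<Longrightarrow> B \<subseteq> A \<Longrightarrow> B \<in> J"
  by (auto simp: is_ideal_def)

lemma ideal_finite: "is_ideal J \<Longrightarrow> finite A \<Longrightarrow> A \<in> J"
  by (simp add: is_ideal_def)

lemma ideal_UNIV: "is_ideal J \<Longrightarrow> UNIV \<notin> J"
  by (simp add: is_ideal_def)

lemma selective_is_ideal: "selective_ideal J \<Longrightarrow> is_ideal J"
  by (simp add: selective_ideal_def)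

lemma positive_superset:
  assumes "is_ideal J" "A \<in> positive J" "A \<subseteq> B"
  shows "B \<in> positive J"
  using assms ideal_subset unfolding positive_def by blast

lemma positive_almost_subset:
  assumes "is_ideal J" "A \<in> positive J" "finite (A - B)"
  shows "A \<inter> B \<in> positive J"
proof (rule ccontr)
  assume "A \<inter> B \<notin> positive J"
  then have "(A \<inter> B) \<union> (A - B) \<in> J"
    using assms ideal_finite ideal_Un unfolding positive_def by blast
  moreover have "(A \<inter> B) \<union> (A - B) = A" by blast
  ultimately show False using assms(2) unfolding positive_def by simp
qed

lemma UN_closed:
  assumes "finite I" "{} \<in> L" "\<And>A B. A \<in> L \<Longrightarrow> B \<in> L \<Longrightarrow> A \<union> B \<in> L"
    "\<And>i. i \<in> I \<Longrightarrow> A i \<in> L"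
  shows "(\<Union>i\<in>I. A i) \<in> L"
  using assms(1,4) by (induction I rule: finite_induct) (auto intro: assms(2,3))

lemma extend_by_Un:
  assumes "is_ideal K" "A \<in> extend_by K \<A>" "B \<in> extend_by K \<A>"
  shows "A \<union> B \<in> extend_by K \<A>"
proof -
  obtain F G where F: "finite F" "F \<subseteq> \<A>" "A - \<Union>F \<in> K"
    and G: "finite G" "G \<subseteq> \<A>" "B - \<Union>G \<in> K"
    using assms unfolding extend_by_def by blast
  have "(A - \<Union>F) \<union> (B - \<Union>G) \<in> K" using ideal_Un assms(1) F G by blast
  then have "(A \<union> B) - \<Union>(F \<union> G) \<in> K" by (rule ideal_subset[OF assms(1)]) blast
  then show ?thesis unfolding extend_by_def using F G by (intro CollectI exI[of _ "F \<union> G"]) auto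
qed

lemma extend_by_subset:
  assumes "is_ideal K" "A \<in> extend_by K \<A>" "B \<subseteq> A"
  shows "B \<in> extend_by K \<A>"
proof -
  obtain F where F: "finite F" "F \<subseteq> \<A>" "A - \<Union>F \<in> K"
    using assms unfolding extend_by_def by blast
  moreover have "B - \<Union>F \<in> K" by (rule ideal_subset[OF assms(1) F(3)]) (use assms in blast)
  ultimately show ?thesis unfolding extend_by_def by blast
qed

lemma extend_by_base: "A \<in> K \<Longrightarrow> A \<in> extend_by K \<A>"
  unfolding extend_by_def by (intro CollectI exI[of _ "{}"]) auto

lemma extend_by_generator:
  assumes "is_ideal K" "A \<in> \<A>"
  shows "A \<in> extend_by K \<A>"
  unfolding extend_by_def using assms ideal_finite[of K "{}"]
  by (intro CollectI exI[of _ "{A}"]) auto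

lemma finite_card_le_1I:
  assumes "\<And>x y. x \<in> A \<Longrightarrow> y \<in> A \<Longrightarrow> x = y"
  shows "finite A \<and> card A \<le> 1"
proof -
  obtain x where "A \<subseteq> {x}" using assms by blast
  moreover have "finite {x}" "card {x} = 1" by auto
  ultimately show ?thesis by (metis card_mono finite_subset)
qed

lemma decseq_difference_index:
  fixes A :: "nat \<Rightarrow> 'a set"
  assumes "decseq A"
  obtains \<phi> :: "'a \<Rightarrow> nat" where "\<And>x n. x \<in> A n \<Longrightarrow> x \<notin> A (Suc n) \<Longrightarrow> \<phi> x = n"
    "\<And>x. x \<notin> (\<Inter>n. A n) \<Longrightarrow> x \<notin> A (Suc (\<phi> x))"
proof
  define \<phi> where "\<phi> x = (LEAST n. x \<notin> A (Suc n))" for x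
  fix x
  show "\<phi> x = n" if x: "x \<in> A n" "x \<notin> A (Suc n)" for n
    unfolding \<phi>_def
  proof (rule Least_equality)
    show "x \<notin> A (Suc n)" by (rule x(2))
    fix k assume "x \<notin> A (Suc k)"
    moreover have "A n \<subseteq> A (Suc k)" if "\<not> n \<le> k"
      by (rule decseqD[OF assms]) (use that in simp)
    ultimately show "n \<le> k" using x(1) by blast
  qed
  assume "x \<notin> (\<Inter>n. A n)"
  then obtain k where "x \<notin> A k" by blast
  then have "x \<notin> A (Suc k)" using decseqD[OF assms, of k "Suc k"] by auto
  then show "x \<notin> A (Suc (\<phi> x))" unfolding \<phi>_def by (rule LeastI)
qed

section \<open>Reducibility of the eventually different ideal\<close>

text \<open>Columns belong to \<open>\<E>\<D>\<close>, and so does every set with at most one point in each column.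
  Conversely, every member of \<open>\<E>\<D>\<close> is covered by finitely many sets of these two kinds.\<close>

lemma ED_le_iff:
  assumes sub: "\<And>A B. A \<in> L \<Longrightarrow> B \<subseteq> A \<Longrightarrow> B \<in> L"
    and un: "\<And>A B. A \<in> L \<Longrightarrow> B \<in> L \<Longrightarrow> A \<union> B \<in> L"
  shows "le_via all_functions ED L \<longleftrightarrow>
    (\<exists>\<phi> :: nat \<Rightarrow> nat. (\<forall>n. \<phi> -` {n} \<in> L) \<and> (\<forall>B. inj_on \<phi> B \<longrightarrow> B \<in> L))"
proof
  assume "le_via all_functions ED L"
  then obtain f where f: "\<And>B. B \<in> ED \<Longrightarrow> f -` B \<in> L"
    unfolding le_via_def by blast
  define \<phi> where "\<phi> = fst \<circ> prod_decode \<circ> f"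
  have "\<phi> -` {n} \<in> L" for n
  proof -
    have "{n} \<times> UNIV \<in> ED_prod"
    proof -
      have "\<forall>\<^sub>F i in cofinite. i \<noteq> n" by (simp add: eventually_cofinite)
      then have "\<forall>\<^sub>F i in cofinite. finite {k::nat. (i, k) \<in> {n} \<times> UNIV}
          \<and> card {k::nat. (i, k) \<in> {n} \<times> UNIV} < 1"
        by (rule eventually_mono) simp
      then show ?thesis unfolding ED_prod_def by blast
    qed
    then have "prod_encode ` ({n} \<times> UNIV) \<in> ED" unfolding ED_def by blast
    from f[OF this] show ?thesis
    proof (rule sub)
      show "\<phi> -` {n} \<subseteq> f -` prod_encode ` ({n} \<times> UNIV)"
      proof
        fix x assume "x \<in> \<phi> -` {n}"
        then have "prod_decode (f x) \<in> {n} \<times> UNIV" by (auto simp: \<phi>_def mem_Times_iff)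
        then have "prod_encode (prod_decode (f x)) \<in> prod_encode ` ({n} \<times> UNIV)" by (rule imageI)
        then show "x \<in> f -` prod_encode ` ({n} \<times> UNIV)" by simp
      qed
    qed
  qed
  moreover have "B \<in> L" if "inj_on \<phi> B" for B
  proof -
    let ?A = "(prod_decode \<circ> f) ` B"
    have "finite {k. (n, k) \<in> ?A} \<and> card {k. (n, k) \<in> ?A} < 2" for n
    proof -
      have "k = l" if "(n, k) \<in> ?A" "(n, l) \<in> ?A" for k l
      proof -
        from that obtain x y where xy: "x \<in> B" "y \<in> B"
          "prod_decode (f x) = (n, k)" "prod_decode (f y) = (n, l)" by (auto simp del: prod_decode_eq)
        then have "\<phi> x = \<phi> y" by (simp add: \<phi>_def)
        then have "x = y" using \<open>inj_on \<phi> B\<close> xy by (auto dest: inj_onD)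
        then show ?thesis using xy by simp
      qed
      then have "finite {k. (n, k) \<in> ?A} \<and> card {k. (n, k) \<in> ?A} \<le> 1"
        by (intro finite_card_le_1I) blast
      then show ?thesis by linarith
    qed
    then have "?A \<in> ED_prod"
      unfolding ED_prod_def by (intro CollectI exI[of _ 2] always_eventually allI)
    then have "prod_encode ` ?A \<in> ED" unfolding ED_def by blast
    from f[OF this] show ?thesis by (rule sub) (auto simp: image_image)
  qed
  ultimately show "\<exists>\<phi> :: nat \<Rightarrow> nat. (\<forall>n. \<phi> -` {n} \<in> L) \<and> (\<forall>B. inj_on \<phi> B \<longrightarrow> B \<in> L)" by blast
next
  assume "\<exists>\<phi> :: nat \<Rightarrow> nat. (\<forall>n. \<phi> -` {n} \<in> L) \<and> (\<forall>B. inj_on \<phi> B \<longrightarrow> B \<in> L)"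
  then obtain \<phi> :: "nat \<Rightarrow> nat"
    where fib: "\<And>n. \<phi> -` {n} \<in> L" and inj: "\<And>B. inj_on \<phi> B \<Longrightarrow> B \<in> L"
    by blast
  have empty: "{} \<in> L" by (rule inj) simp
  define f where "f = (\<lambda>x. prod_encode (\<phi> x, x))"
  have "f -` E \<in> L" if E: "E \<in> ED" for E
  proof -
    obtain A where A: "A \<in> ED_prod" "E = prod_encode ` A"
      using E unfolding ED_def by blast
    define C where "C n = {k. (n, k) \<in> A}" for n
    obtain m where m: "\<forall>\<^sub>F n in cofinite. finite (C n) \<and> card (C n) < m"
      using A(1) unfolding ED_prod_def C_def by blast
    define N where "N = {n. \<not> (finite (C n) \<and> card (C n) < m)}"
    have finN: "finite N" using m by (simp add: eventually_cofinite N_def)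
    \<comment> \<open>The labels \<open>h n\<close> split the part of \<open>A\<close> outside the columns in \<open>N\<close> into \<open>m\<close> sets with at
      most one point per column.\<close>
    have "\<exists>h. inj_on h (C n) \<and> h ` C n \<subseteq> {..<m}" if "n \<notin> N" for n
    proof -
      have "finite (C n)" "card (C n) \<le> card {..<m}" using that by (auto simp: N_def)
      then show ?thesis using card_le_inj[of "C n" "{..<m}"] by blast
    qed
    then obtain h where h: "\<And>n. n \<notin> N \<Longrightarrow> inj_on (h n) (C n) \<and> h n ` C n \<subseteq> {..<m}"
      by metis
    define P where "P i = {x. \<phi> x \<notin> N \<and> x \<in> C (\<phi> x) \<and> h (\<phi> x) x = i}" for i
    have "P i \<in> L" for i
    proof (rule inj, rule inj_onI)
      fix x y assume "x \<in> P i" "y \<in> P i" "\<phi> x = \<phi> y"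
      then show "x = y" using h[of "\<phi> x"] by (auto simp: P_def dest: inj_onD)
    qed
    then have "(\<Union>i\<in>{..<m}. P i) \<in> L" by (intro UN_closed empty un) auto
    moreover have "(\<Union>n\<in>N. \<phi> -` {n}) \<in> L" using finN fib by (intro UN_closed empty un) auto
    ultimately have "(\<Union>i\<in>{..<m}. P i) \<union> (\<Union>n\<in>N. \<phi> -` {n}) \<in> L" by (rule un)
    then show ?thesis
    proof (rule sub)
      show "f -` E \<subseteq> (\<Union>i\<in>{..<m}. P i) \<union> (\<Union>n\<in>N. \<phi> -` {n})"
      proof
        fix x assume "x \<in> f -` E"
        then have x: "x \<in> C (\<phi> x)"
          unfolding A(2) f_def C_def by (auto simp: inj_image_mem_iff[OF inj_prod_encode])
        show "x \<in> (\<Union>i\<in>{..<m}. P i) \<union> (\<Union>n\<in>N. \<phi> -` {n})"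
        proof (cases "\<phi> x \<in> N")
          case False
          then have "h (\<phi> x) x < m" using h x by blast
          then show ?thesis using False x by (auto simp: P_def)
        qed auto
      qed
    qed
  qed
  then show "le_via all_functions ED L" unfolding le_via_def all_functions_def by blast
qed

lemma ED_le_extend_by_iff:
  assumes id: "is_ideal K"
  shows "le_via all_functions ED (extend_by K \<A>) \<longleftrightarrow>
    (\<exists>\<phi> :: nat \<Rightarrow> nat. (\<forall>n. \<phi> -` {n} \<in> extend_by K \<A>) \<and>
      (\<forall>B. inj_on \<phi> B \<longrightarrow> B \<in> extend_by K \<A>))"
  by (rule ED_le_iff) (blast intro: extend_by_subset[OF id] extend_by_Un[OF id])+

section \<open>Selective ideals\<close>

lemma selective_idealE:
  assumes "selective_ideal K" "decseq A" "\<And>n. A n \<in> positive K"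
  obtains B where "B \<in> positive K" "B \<subseteq> A 0"
    "\<And>n. finite (B \<inter> (A n - A (Suc n))) \<and> card (B \<inter> (A n - A (Suc n))) \<le> 1"
proof -
  have "decseq A \<and> (\<forall>n. A n \<in> positive K)" using assms by blast
  from assms(1)[unfolded selective_ideal_def, THEN conjunct2, THEN spec[of _ A], THEN mp, OF this]
  show thesis using that by (elim bexE conjE) simp
qed

lemma selective_pseudointersection:
  assumes sel: "selective_ideal K" and dec: "decseq A" and pos: "\<And>n. A n \<in> positive K"
  obtains B where "B \<in> positive K" "B \<subseteq> A 0" "\<And>n. finite (B - A n)"
proof -
  obtain B where B: "B \<in> positive K" "B \<subseteq> A 0"
    "\<And>n. finite (B \<inter> (A n - A (Suc n))) \<and> card (B \<inter> (A n - A (Suc n))) \<le> 1"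
    using selective_idealE[OF sel dec pos] by blast
  have "finite (B - A n)" for n
  proof (induction n)
    case 0
    then show ?case using B(2) by (simp add: Diff_eq_empty_iff[THEN iffD2])
  next
    case (Suc n)
    have "B - A (Suc n) \<subseteq> (B - A n) \<union> (B \<inter> (A n - A (Suc n)))" by blast
    then show ?case using Suc B(3)[of n] by (meson finite_UnI finite_subset)
  qed
  then show thesis using that B by blast
qed

lemma selective_injective:
  fixes \<phi> :: "nat \<Rightarrow> nat"
  assumes sel: "selective_ideal K" and C: "C \<in> positive K"
    and fib: "\<And>n. C \<inter> \<phi> -` {n} \<in> K"
  obtains B where "B \<in> positive K" "B \<subseteq> C" "inj_on \<phi> B"
proof -
  note id = selective_is_ideal[OF sel]
  define A where "A n = C \<inter> {x. n \<le> \<phi> x}" for n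
  have "decseq A" by (auto simp: decseq_def A_def)
  moreover have "A n \<in> positive K" for n
  proof (induction n)
    case 0
    then show ?case using C by (simp add: A_def)
  next
    case (Suc n)
    show ?case
    proof (rule ccontr)
      assume "A (Suc n) \<notin> positive K"
      then have "A (Suc n) \<union> (C \<inter> \<phi> -` {n}) \<in> K"
        using ideal_Un[OF id] fib unfolding positive_def by blast
      then have "A n \<in> K" by (rule ideal_subset[OF id]) (auto simp: A_def)
      then show False using Suc by (simp add: positive_def)
    qed
  qed
  ultimately obtain B where B: "B \<in> positive K" "B \<subseteq> A 0"
    "\<And>n. finite (B \<inter> (A n - A (Suc n))) \<and> card (B \<inter> (A n - A (Suc n))) \<le> 1"
    using selective_idealE[OF sel] by blast
  have "B \<subseteq> C" using B(2) by (auto simp: A_def)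
  moreover have "inj_on \<phi> B"
  proof (rule inj_onI)
    fix x y assume "x \<in> B" "y \<in> B" "\<phi> x = \<phi> y"
    then have "x \<in> B \<inter> (A (\<phi> x) - A (Suc (\<phi> x)))" "y \<in> B \<inter> (A (\<phi> x) - A (Suc (\<phi> x)))"
      using \<open>B \<subseteq> C\<close> by (auto simp: A_def)
    then show "x = y" using B(3)[of "\<phi> x"] card_le_Suc0_iff_eq by (metis One_nat_def)
  qed
  ultimately show thesis using that B(1) by blast
qed

lemma selective_ideal_not_ED_le:
  assumes sel: "selective_ideal K" and cnt: "countable \<A>" and proper: "UNIV \<notin> extend_by K \<A>"
  shows "\<not> le_via all_functions ED (extend_by K \<A>)"
proof
  let ?L = "extend_by K \<A>"
  note id = selective_is_ideal[OF sel]
  have empty: "{} \<in> ?L" using extend_by_base ideal_finite[OF id] by blast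
  assume "le_via all_functions ED ?L"
  then obtain \<phi> :: "nat \<Rightarrow> nat"
    where fib: "\<And>n. \<phi> -` {n} \<in> ?L" and inj: "\<And>B. inj_on \<phi> B \<Longrightarrow> B \<in> ?L"
    unfolding ED_le_extend_by_iff[OF id] by blast
  define a where "a = from_nat_into (insert {} \<A>)"
  have ran: "range a = insert {} \<A>" unfolding a_def using cnt by (intro range_from_nat_into) auto
  have aL: "a i \<in> ?L" for i
  proof -
    have "a i \<in> insert {} \<A>" using ran by blast
    then show ?thesis using empty extend_by_generator[OF id] by auto
  qed
  define D where "D n = UNIV - (\<Union>i\<in>{..<n}. a i \<union> \<phi> -` {i})" for n
  have "decseq D" unfolding decseq_def D_def by (intro allI impI Diff_mono UN_mono) auto
  moreover have "D n \<in> positive K" for n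
  proof (rule ccontr)
    assume "D n \<notin> positive K"
    then have "D n \<in> ?L" using extend_by_base by (auto simp: positive_def)
    moreover have "(\<Union>i\<in>{..<n}. a i \<union> \<phi> -` {i}) \<in> ?L"
      by (intro UN_closed empty extend_by_Un[OF id] fib aL) auto
    ultimately have "D n \<union> (\<Union>i\<in>{..<n}. a i \<union> \<phi> -` {i}) \<in> ?L"
      by (rule extend_by_Un[OF id])
    then show False using proper by (simp add: D_def)
  qed
  ultimately obtain B where B: "B \<in> positive K" "\<And>n. finite (B - D n)"
    using selective_pseudointersection[OF sel] by metis
  have "B \<inter> \<phi> -` {n} \<in> K" for n
    by (rule ideal_finite[OF id], rule finite_subset[OF _ B(2)[of "Suc n"]]) (auto simp: D_def)
  from selective_injective[OF sel B(1) this]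
  obtain B' where B': "B' \<in> positive K" "B' \<subseteq> B" "inj_on \<phi> B'" .
  obtain F where F: "finite F" "F \<subseteq> \<A>" "B' - \<Union>F \<in> K"
    using inj[OF B'(3)] unfolding extend_by_def by blast
  have "finite (B' \<inter> A)" if A: "A \<in> F" for A
  proof -
    obtain i where "A = a i" using A F(2) ran by blast
    then have "B' \<inter> A \<subseteq> B - D (Suc i)" using B'(2) by (auto simp: D_def)
    then show ?thesis using B(2) finite_subset by blast
  qed
  then have "finite (\<Union>A\<in>F. B' \<inter> A)" using F(1) by blast
  then have "(B' - \<Union>F) \<union> (\<Union>A\<in>F. B' \<inter> A) \<in> K"
    using F(3) ideal_Un[OF id] ideal_finite[OF id] by blast
  moreover have "(B' - \<Union>F) \<union> (\<Union>A\<in>F. B' \<inter> A) = B'" by blast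
  ultimately show False using B'(1) by (simp add: positive_def)
qed

lemma selective_ideal_if_not_ED_le:
  assumes id: "is_ideal K"
    and ED: "\<And>\<A>. countable \<A> \<Longrightarrow> UNIV \<notin> extend_by K \<A> \<Longrightarrow>
      \<not> le_via all_functions ED (extend_by K \<A>)"
  shows "selective_ideal K"
  unfolding selective_ideal_def
proof (intro conjI id allI impI)
  fix D :: "nat \<Rightarrow> nat set"
  assume "decseq D \<and> (\<forall>n. D n \<in> positive K)"
  then have dec: "decseq D" and pos: "\<And>n. D n \<in> positive K" by auto
  let ?goal = "\<exists>B\<in>positive K. B \<subseteq> D 0 \<and>
    (\<forall>n. finite (B \<inter> (D n - D (Suc n))) \<and> card (B \<inter> (D n - D (Suc n))) \<le> 1)"
  define I where "I = (\<Inter>n. D n)"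
  show ?goal
  proof (cases "I \<in> K")
    case False
    have "I \<inter> (D n - D (Suc n)) = {}" for n by (auto simp: I_def)
    then show ?thesis using False by (intro bexI[of _ I]) (auto simp: positive_def I_def)
  next
    case True
    define \<A> where "\<A> = range (\<lambda>n. - D n)"
    let ?L = "extend_by K \<A>"
    have compl: "- D n \<in> ?L" for n
      by (rule extend_by_generator[OF id]) (simp add: \<A>_def)
    have "UNIV \<notin> ?L"
    proof
      assume "UNIV \<in> ?L"
      then obtain F where F: "finite F" "F \<subseteq> \<A>" "UNIV - \<Union>F \<in> K"
        unfolding extend_by_def by blast
      then obtain S where S: "finite S" "F = (\<lambda>n. - D n) ` S"
        unfolding \<A>_def by (meson finite_subset_image)
      obtain n where "\<forall>s\<in>S. s \<le> n" using S(1) finite_nat_set_iff_bounded_le by blast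
      then have "D n \<subseteq> UNIV - \<Union>F" using dec S(2) by (auto simp: decseq_def)
      then show False using ideal_subset[OF id F(3)] pos by (auto simp: positive_def)
    qed
    then have nle: "\<not> le_via all_functions ED ?L" by (intro ED) (simp add: \<A>_def)
    \<comment> \<open>On \<open>D 0 - I\<close>, the value of \<open>\<phi>\<close> is the index of the difference containing the argument.
      Elsewhere the value is irrelevant, both \<open>- D 0\<close> and \<open>I\<close> being in \<open>?L\<close>.\<close>
    obtain \<phi> :: "nat \<Rightarrow> nat" where \<phi>: "\<And>x n. x \<in> D n \<Longrightarrow> x \<notin> D (Suc n) \<Longrightarrow> \<phi> x = n"
      and \<phi>': "\<And>x. x \<notin> I \<Longrightarrow> x \<notin> D (Suc (\<phi> x))"
      using decseq_difference_index[OF dec] unfolding I_def by metis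
    have "\<phi> -` {n} \<in> ?L" for n
    proof -
      have "- D (Suc n) \<union> I \<in> ?L" using compl extend_by_base[OF True] extend_by_Un[OF id] by blast
      then show ?thesis
        by (rule extend_by_subset[OF id]) (use \<phi>' in auto)
    qed
    then obtain B where B: "inj_on \<phi> B" "B \<notin> ?L"
      using nle unfolding ED_le_extend_by_iff[OF id] by blast
    have "B \<inter> D 0 \<in> positive K"
    proof (rule ccontr)
      assume "B \<inter> D 0 \<notin> positive K"
      then have "(B \<inter> D 0) \<union> - D 0 \<in> ?L"
        using extend_by_base compl extend_by_Un[OF id] unfolding positive_def by blast
      then have "B \<in> ?L" by (rule extend_by_subset[OF id]) blast
      then show False using B(2) by blast
    qed
    moreover have "finite (B \<inter> D 0 \<inter> (D n - D (Suc n))) \<and>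
      card (B \<inter> D 0 \<inter> (D n - D (Suc n))) \<le> 1" for n
    proof -
      have "x = y" if "x \<in> B \<inter> D 0 \<inter> (D n - D (Suc n))" "y \<in> B \<inter> D 0 \<inter> (D n - D (Suc n))" for x y
        using that \<phi>[of x n] \<phi>[of y n] B(1) by (auto dest: inj_onD)
      then show ?thesis by (rule finite_card_le_1I)
    qed
    moreover have "B \<inter> D 0 \<subseteq> D 0" by blast
    ultimately show ?goal by meson
  qed
qed

theorem selective_ideal_iff_not_ED_le:
  assumes "is_ideal K"
  shows "selective_ideal K \<longleftrightarrow> (\<forall>\<A>. countable \<A> \<and> UNIV \<notin> extend_by K \<A> \<longrightarrow>
    \<not> le_via all_functions ED (extend_by K \<A>))"
proof
  assume "selective_ideal K"
  then show "\<forall>\<A>. countable \<A> \<and> UNIV \<notin> extend_by K \<A> \<longrightarrow>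
      \<not> le_via all_functions ED (extend_by K \<A>)"
    by (intro allI impI) (rule selective_ideal_not_ED_le; simp)
next
  assume "\<forall>\<A>. countable \<A> \<and> UNIV \<notin> extend_by K \<A> \<longrightarrow>
    \<not> le_via all_functions ED (extend_by K \<A>)"
  then show "selective_ideal K" by (intro selective_ideal_if_not_ED_le[OF assms]) simp
qed

lemma not_preceq_ED_iff:
  "\<not> preceq_omega1 all_functions G ED J \<longleftrightarrow> (\<exists>K. selective_ideal K \<and> le_via G J K)"
proof -
  have "\<not> preceq_omega1 all_functions G ED J \<longleftrightarrow> (\<exists>K. is_ideal K \<and> le_via G J K \<and>
    (\<forall>\<A>. countable \<A> \<and> UNIV \<notin> extend_by K \<A> \<longrightarrow>
      \<not> le_via all_functions ED (extend_by K \<A>)))"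
    unfolding preceq_omega1_def by (simp add: imp_conjL disj_imp)
  then show ?thesis using selective_ideal_iff_not_ED_le selective_is_ideal by metis
qed

lemma le_via_mono: "F \<subseteq> G \<Longrightarrow> le_via F I K \<Longrightarrow> le_via G I K"
  unfolding le_via_def by blast

lemma one_to_one_subset: "one_to_one \<subseteq> finite_to_one"
  unfolding one_to_one_def finite_to_one_def by (auto intro: finite_vimageI)

lemma le_via_one_to_one_if_subset: "J \<subseteq> K \<Longrightarrow> le_via one_to_one J K"
  unfolding le_via_def one_to_one_def by (intro bexI[of _ id]) auto

lemma extendable_if_le_selective:
  assumes J: "is_ideal J" and sel: "selective_ideal K" and le: "le_via all_functions J K"
  shows "extendable_to_selective J"
proof -
  note id = selective_is_ideal[OF sel]
  obtain f where f: "\<And>A. A \<in> J \<Longrightarrow> f -` A \<in> K" using le unfolding le_via_def by blast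
  have "UNIV \<in> positive K" using ideal_UNIV[OF id] by (simp add: positive_def)
  moreover have "UNIV \<inter> f -` {n} \<in> K" for n using f ideal_finite[OF J] by simp
  ultimately obtain B where B: "B \<in> positive K" "inj_on f B"
    using selective_injective[OF sel] by metis
  define J' where "J' = {A. f -` A \<inter> B \<in> K}"
  have "J \<subseteq> J'" by (auto simp: J'_def intro: ideal_subset[OF id f])
  have pos: "A \<in> positive J' \<longleftrightarrow> f -` A \<inter> B \<in> positive K" for A
    by (simp add: J'_def positive_def)
  have id': "is_ideal J'"
    unfolding is_ideal_def
  proof (intro conjI ballI allI impI)
    fix A C assume "A \<in> J'" "C \<in> J'"
    then have "(f -` A \<inter> B) \<union> (f -` C \<inter> B) \<in> K" using ideal_Un[OF id] by (simp add: J'_def)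
    moreover have "(f -` A \<inter> B) \<union> (f -` C \<inter> B) = f -` (A \<union> C) \<inter> B" by blast
    ultimately show "A \<union> C \<in> J'" by (simp add: J'_def)
  next
    fix A C assume "A \<in> J'" "C \<subseteq> A"
    then have "f -` A \<inter> B \<in> K" "f -` C \<inter> B \<subseteq> f -` A \<inter> B" by (auto simp: J'_def)
    then have "f -` C \<inter> B \<in> K" by (rule ideal_subset[OF id])
    then show "C \<in> J'" by (simp add: J'_def)
  next
    fix A :: "nat set" assume "finite A"
    then show "A \<in> J'" using \<open>J \<subseteq> J'\<close> ideal_finite[OF J] by blast
  next
    show "UNIV \<notin> J'" using B(1) by (simp add: J'_def positive_def)
  qed
  have "selective_ideal J'"
    unfolding selective_ideal_def
  proof (intro conjI id' allI impI)
    fix A :: "nat \<Rightarrow> nat set"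
    assume A: "decseq A \<and> (\<forall>n. A n \<in> positive J')"
    define A' where "A' n = f -` A n \<inter> B" for n
    have "decseq A'" using A by (fastforce simp: decseq_def A'_def)
    moreover have "A' n \<in> positive K" for n using A pos by (simp add: A'_def)
    ultimately obtain C where C: "C \<in> positive K" "C \<subseteq> A' 0"
      "\<And>n. finite (C \<inter> (A' n - A' (Suc n))) \<and> card (C \<inter> (A' n - A' (Suc n))) \<le> 1"
      using selective_idealE[OF sel] by blast
    have CB: "C \<subseteq> B" using C(2) by (auto simp: A'_def)
    show "\<exists>C\<in>positive J'. C \<subseteq> A 0 \<and>
      (\<forall>n. finite (C \<inter> (A n - A (Suc n))) \<and> card (C \<inter> (A n - A (Suc n))) \<le> 1)"
    proof (intro bexI[of _ "f ` C"] conjI allI)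
      show "f ` C \<in> positive J'"
        unfolding pos by (rule positive_superset[OF id C(1)]) (use CB in blast)
      show "f ` C \<subseteq> A 0" using C(2) by (auto simp: A'_def)
      fix n
      have eq: "f ` C \<inter> (A n - A (Suc n)) = f ` (C \<inter> (A' n - A' (Suc n)))"
        using CB by (auto simp: A'_def)
      show "finite (f ` C \<inter> (A n - A (Suc n)))" unfolding eq using C(3) by blast
      show "card (f ` C \<inter> (A n - A (Suc n))) \<le> 1"
        unfolding eq using C(3)[of n] card_image_le le_trans by blast
    qed
  qed
  then show ?thesis using \<open>J \<subseteq> J'\<close> unfolding extendable_to_selective_def by blast
qed

section \<open>Selective ultrafilters under the continuum hypothesis\<close>

lemma selective_pseudointersection_chain:
  assumes sel: "selective_ideal K" and cnt: "countable \<C>" and pos: "\<C> \<subseteq> positive K"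
    and chain: "\<And>A B. A \<in> \<C> \<Longrightarrow> B \<in> \<C> \<Longrightarrow> finite (A - B) \<or> finite (B - A)"
  obtains Y where "Y \<in> positive K" "\<And>A. A \<in> \<C> \<Longrightarrow> finite (Y - A)"
proof (cases "\<C> = {}")
  case True
  then show thesis using that[of UNIV] ideal_UNIV selective_is_ideal[OF sel]
    by (auto simp: positive_def)
next
  case False
  note id = selective_is_ideal[OF sel]
  define c where "c = from_nat_into \<C>"
  have ran: "range c = \<C>" unfolding c_def using cnt False by (intro range_from_nat_into)
  define A where "A n = (\<Inter>i\<in>{..n}. c i)" for n
  have "\<exists>j\<le>n. finite (c j - A n)" for n
  proof (induction n)
    case 0
    then show ?case by (simp add: A_def)
  next
    case (Suc n)
    then obtain j where j: "j \<le> n" "finite (c j - A n)" by blast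
    have AS: "A (Suc n) = A n \<inter> c (Suc n)" by (auto simp: A_def atMost_Suc)
    consider "finite (c j - c (Suc n))" | "finite (c (Suc n) - c j)"
      using chain ran by blast
    then show ?case
    proof cases
      case 1
      have "c j - A (Suc n) \<subseteq> (c j - A n) \<union> (c j - c (Suc n))" by (auto simp: AS)
      then show ?thesis using 1 j by (meson finite_UnI finite_subset le_SucI)
    next
      case 2
      have "c (Suc n) - A (Suc n) \<subseteq> (c j - A n) \<union> (c (Suc n) - c j)" by (auto simp: AS)
      then show ?thesis using 2 j by (meson finite_UnI finite_subset order_refl)
    qed
  qed
  then have "A n \<in> positive K" for n
    using positive_almost_subset[OF id] positive_superset[OF id] pos ran
    by (metis inf_le2 rangeI subsetD)
  moreover have "decseq A" unfolding decseq_def A_def by (intro allI impI INF_superset_mono) auto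
  ultimately obtain Y where Y: "Y \<in> positive K" "\<And>n. finite (Y - A n)"
    using selective_pseudointersection[OF sel] by metis
  have "finite (Y - D)" if D: "D \<in> \<C>" for D
  proof -
    obtain i where "D = c i" using D ran by blast
    then have "Y - D \<subseteq> Y - A i" by (auto simp: A_def)
    then show ?thesis using Y(2) finite_subset by blast
  qed
  then show thesis using that Y(1) by blast
qed

lemma selective_constant_or_injective:
  fixes f :: "nat \<Rightarrow> nat"
  assumes sel: "selective_ideal K" and C: "C \<in> positive K"
  obtains B where "B \<in> positive K" "B \<subseteq> C" "(\<exists>n. B \<subseteq> f -` {n}) \<or> inj_on f B"
proof (cases "\<exists>n. C \<inter> f -` {n} \<in> positive K")
  case True
  then show thesis using that by blast
next
  case False
  then have "C \<inter> f -` {n} \<in> K" for n by (simp add: positive_def)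
  then show thesis using selective_injective[OF sel C] that by metis
qed

text \<open>Under CH, the functions on \<open>\<omega>\<close> carry a well-order of type at most \<open>\<omega>\<^sub>1\<close>.  The relation \<open>r\<close>
  is its strict part.\<close>

lemma CH_wellorder:
  includes cardinal_syntax
  assumes CH
  obtains r :: "((nat \<Rightarrow> nat) \<times> (nat \<Rightarrow> nat)) set"
  where "wf r" "\<And>f g. f \<noteq> g \<Longrightarrow> (f, g) \<in> r \<or> (g, f) \<in> r" "\<And>f. countable {g. (g, f) \<in> r}"
proof -
  define r where "r = card_of (UNIV :: (nat \<Rightarrow> nat) set)"
  have wo: "Well_order r" and fld: "Field r = UNIV" and co: "Card_order r"
    unfolding r_def by (rule card_of_Well_order Field_card_of card_of_Card_order)+
  have lin: "Linear_order r" and wf: "wf (r - Id)"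
    using wo unfolding well_order_on_def by auto
  have tot: "(f, g) \<in> r - Id \<or> (g, f) \<in> r - Id" if "f \<noteq> g" for f g
    using lin that fld unfolding linear_order_on_def total_on_def by auto
  have "inj (\<lambda>f. range (\<lambda>n. prod_encode (n, f n :: nat)))"
  proof (rule injI, rule ext)
    fix f g :: "nat \<Rightarrow> nat" and n
    assume "range (\<lambda>n. prod_encode (n, f n)) = range (\<lambda>n. prod_encode (n, g n))"
    then have "prod_encode (n, f n) \<in> range (\<lambda>n. prod_encode (n, g n))" by blast
    then show "f n = g n" by auto
  qed
  then have "r \<le>o card_of (UNIV :: nat set set)"
    unfolding r_def using card_of_ordLeq by blast
  then have rle: "r \<le>o cardSuc natLeq"
    using assms ordLeq_ordIso_trans unfolding CH_def by blast
  have "countable {g. (g, f) \<in> r - Id}" for f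
  proof -
    have eq: "{g. (g, f) \<in> r - Id} = underS r f" by (auto simp: underS_def)
    have "card_of (underS r f) <o r" using card_of_underS[OF co] fld by blast
    then have "card_of (underS r f) <o cardSuc natLeq" using rle ordLess_ordLeq_trans by blast
    then have "card_of (underS r f) \<le>o natLeq"
      using cardSuc_ordLeq_ordLess[OF natLeq_Card_order card_of_Card_order] by blast
    then show ?thesis unfolding eq by (simp add: countable_card_le_natLeq)
  qed
  then show thesis using that[OF wf tot] by blast
qed

text \<open>The sets \<open>X f\<close> form a chain under inclusion modulo finite sets and generate a Ramsey
  ultrafilter.\<close>

lemma CH_tower:
  assumes CH and sel: "selective_ideal K"
  obtains X :: "(nat \<Rightarrow> nat) \<Rightarrow> nat set"
  where "\<And>f. X f \<in> positive K" "\<And>f. (\<exists>n. X f \<subseteq> f -` {n}) \<or> inj_on f (X f)"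
    "\<And>f g. finite (X f - X g) \<or> finite (X g - X f)"
proof -
  obtain r :: "((nat \<Rightarrow> nat) \<times> (nat \<Rightarrow> nat)) set" where wf: "wf r"
    and tot: "\<And>f g. f \<noteq> g \<Longrightarrow> (f, g) \<in> r \<or> (g, f) \<in> r" and cnt: "\<And>f. countable {g. (g, f) \<in> r}"
    using CH_wellorder[OF \<open>CH\<close>] by metis
  define Q where "Q X f Y \<longleftrightarrow> Y \<in> positive K \<and> ((\<exists>n. Y \<subseteq> f -` {n}) \<or> inj_on f Y) \<and>
    (\<forall>g. (g, f) \<in> r \<longrightarrow> finite (Y - X g))" for X f Y
  define X where "X = wfrec r (\<lambda>X f. SOME Y. Q X f Y)"
  have Xrec: "X f = (SOME Y. Q X f Y)" for f
  proof -
    have "X f = (SOME Y. Q (cut X r f) f Y)"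
      unfolding X_def by (rule wfrec[OF wf])
    moreover have "Q (cut X r f) f = Q X f" by (auto simp: Q_def cut_def fun_eq_iff)
    ultimately show ?thesis by simp
  qed
  have Q: "Q X f (X f)" for f
    using wf
  proof (induction f rule: wf_induct_rule)
    case (less f)
    let ?C = "X ` {g. (g, f) \<in> r}"
    have alm: "finite (X g - X h)" if "(h, g) \<in> r" "(g, f) \<in> r" for g h
      using less[OF that(2)] that(1) unfolding Q_def by blast
    have chain: "finite (A - B) \<or> finite (B - A)" if AB: "A \<in> ?C" "B \<in> ?C" for A B
    proof -
      obtain g h where "(g, f) \<in> r" "(h, f) \<in> r" "A = X g" "B = X h" using AB by blast
      then show ?thesis using alm tot[of g h] by (cases "g = h") auto
    qed
    have "countable ?C" using cnt by simp
    moreover have "?C \<subseteq> positive K" using less unfolding Q_def by blast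
    ultimately obtain Z where Z: "Z \<in> positive K" "\<And>A. A \<in> ?C \<Longrightarrow> finite (Z - A)"
      using selective_pseudointersection_chain[OF sel, of ?C] chain by blast
    obtain Y where Y: "Y \<in> positive K" "Y \<subseteq> Z" "(\<exists>n. Y \<subseteq> f -` {n}) \<or> inj_on f Y"
      using selective_constant_or_injective[OF sel Z(1)] by blast
    have "finite (Y - X g)" if "(g, f) \<in> r" for g
      using Z(2)[of "X g"] that Y(2) by (meson Diff_mono finite_subset image_eqI mem_Collect_eq order_refl)
    then have "Q X f Y" using Y unfolding Q_def by blast
    then show ?case unfolding Xrec[of f] by (rule someI)
  qed
  show thesis
  proof (rule that[of X])
    show "finite (X f - X g) \<or> finite (X g - X f)" for f g
      using Q[of f] Q[of g] tot[of f g] unfolding Q_def by (cases "f = g") auto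
  qed (use Q in \<open>auto simp: Q_def\<close>)
qed

lemma dual_ideal_iff: "A \<in> dual_ideal U \<longleftrightarrow> - A \<in> U"
  unfolding dual_ideal_def by (auto intro: exI[of _ "- A"])

lemma ultrafilter_Compl_iff:
  assumes "is_ultrafilter U"
  shows "- A \<in> U \<longleftrightarrow> A \<notin> U"
proof
  assume "- A \<in> U"
  show "A \<notin> U"
  proof
    assume "A \<in> U"
    then have "A \<inter> - A \<in> U" using \<open>- A \<in> U\<close> assms unfolding is_ultrafilter_def by blast
    then show False using assms unfolding is_ultrafilter_def by simp
  qed
qed (use assms in \<open>auto simp: is_ultrafilter_def\<close>)

lemma positive_dual_ideal: "is_ultrafilter U \<Longrightarrow> positive (dual_ideal U) = U"
  by (auto simp: positive_def dual_ideal_iff ultrafilter_Compl_iff)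

lemma is_ideal_dual_ideal:
  assumes "is_ultrafilter U"
  shows "is_ideal (dual_ideal U)"
  unfolding is_ideal_def
proof (intro conjI ballI allI impI)
  fix A B assume "A \<in> dual_ideal U" "B \<in> dual_ideal U"
  then show "A \<union> B \<in> dual_ideal U" using assms by (simp add: dual_ideal_iff is_ultrafilter_def)
next
  fix A B assume "A \<in> dual_ideal U" and "B \<subseteq> A"
  then have "- A \<in> U" "- A \<subseteq> - B" by (auto simp: dual_ideal_iff)
  then show "B \<in> dual_ideal U"
    using assms unfolding dual_ideal_iff is_ultrafilter_def by blast
qed (use assms in \<open>simp_all add: dual_ideal_iff is_ultrafilter_def\<close>)

lemma selective_ultrafilterI:
  assumes U: "is_ultrafilter U"
    and ramsey: "\<And>f :: nat \<Rightarrow> nat. \<exists>X\<in>U. (\<exists>n. X \<subseteq> f -` {n}) \<or> inj_on f X"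
  shows "selective_ultrafilter U"
  unfolding selective_ultrafilter_def selective_ideal_def positive_dual_ideal[OF U]
proof (intro conjI U is_ideal_dual_ideal allI impI)
  fix A :: "nat \<Rightarrow> nat set"
  assume "decseq A \<and> (\<forall>n. A n \<in> U)"
  then have dec: "decseq A" and AU: "\<And>n. A n \<in> U" by auto
  have int: "B \<inter> C \<in> U" if "B \<in> U" "C \<in> U" for B C
    using U that unfolding is_ultrafilter_def by blast
  have ne: "{} \<notin> U" using U unfolding is_ultrafilter_def by blast
  obtain \<phi> :: "nat \<Rightarrow> nat" where \<phi>: "\<And>x n. x \<in> A n \<Longrightarrow> x \<notin> A (Suc n) \<Longrightarrow> \<phi> x = n"
    and \<phi>': "\<And>x. x \<notin> (\<Inter>n. A n) \<Longrightarrow> x \<notin> A (Suc (\<phi> x))"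
    using decseq_difference_index[OF dec] by metis
  \<comment> \<open>If \<open>f\<close> is constant on a set in \<open>U\<close>, the value is \<open>0\<close>: a fibre over \<open>Suc n\<close> misses \<open>A (Suc n)\<close>.\<close>
  define f where "f x = (if x \<in> (\<Inter>n. A n) then 0 else Suc (\<phi> x))" for x
  have f: "f x = Suc n" if "x \<in> A n" "x \<notin> A (Suc n)" for x n
    using \<phi>[OF that] that(2) by (auto simp: f_def)
  have f': "x \<notin> A (Suc n)" if "f x = Suc n" for x n
    using \<phi>'[of x] that by (auto simp: f_def split: if_splits)
  obtain X where X: "X \<in> U" "(\<exists>n. X \<subseteq> f -` {n}) \<or> inj_on f X" using ramsey by blast
  have "finite (X \<inter> A 0 \<inter> (A n - A (Suc n))) \<and> card (X \<inter> A 0 \<inter> (A n - A (Suc n))) \<le> 1" for n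
    using X(2)
  proof
    assume "\<exists>n. X \<subseteq> f -` {n}"
    then obtain k where k: "X \<subseteq> f -` {k}" by blast
    have "k \<noteq> Suc n"
    proof
      assume "k = Suc n"
      then have "X \<inter> A (Suc n) = {}" using k f' by auto
      then show False using int[OF X(1) AU] ne by metis
    qed
    then have "X \<inter> A 0 \<inter> (A n - A (Suc n)) = {}" using k f by fastforce
    then show ?thesis by simp
  next
    assume inj: "inj_on f X"
    have "x = y" if "x \<in> X \<inter> A 0 \<inter> (A n - A (Suc n))" "y \<in> X \<inter> A 0 \<inter> (A n - A (Suc n))" for x y
      by (rule inj_onD[OF inj]) (use that f[of x n] f[of y n] in auto)
    then show ?thesis by (rule finite_card_le_1I)
  qed
  then show "\<exists>B\<in>U. B \<subseteq> A 0 \<and>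
      (\<forall>n. finite (B \<inter> (A n - A (Suc n))) \<and> card (B \<inter> (A n - A (Suc n))) \<le> 1)"
    using int[OF X(1) AU[of 0]] by (meson inf_le2)
qed

lemma CH_selective_ultrafilter:
  assumes CH and sel: "selective_ideal K"
  obtains U where "selective_ultrafilter U" "K \<subseteq> dual_ideal U"
proof -
  note id = selective_is_ideal[OF sel]
  obtain X :: "(nat \<Rightarrow> nat) \<Rightarrow> nat set" where pos: "\<And>f. X f \<in> positive K"
    and ramsey: "\<And>f. (\<exists>n. X f \<subseteq> f -` {n}) \<or> inj_on f (X f)"
    and chain: "\<And>f g. finite (X f - X g) \<or> finite (X g - X f)"
    using CH_tower[OF \<open>CH\<close> sel] by metis
  have inf: "infinite (X f)" for f using pos ideal_finite[OF id] by (auto simp: positive_def)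
  define U where "U = {A. \<exists>f. finite (X f - A)}"
  have UI: "A \<in> U" if "finite (X f - A)" for A f using that by (auto simp: U_def)
  have XU: "X f \<in> U" for f by (rule UI[of f]) simp
  have sup: "B \<in> U" if A: "A \<in> U" "A \<subseteq> B" for A B
  proof -
    obtain f where "finite (X f - A)" using A by (auto simp: U_def)
    then have "finite (X f - B)" by (rule finite_subset[rotated]) (use A in blast)
    then show ?thesis by (rule UI)
  qed
  have split: "A \<in> U \<or> - A \<in> U" for A
  proof -
    \<comment> \<open>The characteristic function of \<open>A\<close> is not injective on an infinite set.\<close>
    define f where "f x = (if x \<in> A then 1 else 0 :: nat)" for x
    have "\<not> inj_on f (X f)"
    proof
      assume "inj_on f (X f)"
      moreover have "f ` X f \<subseteq> {0, 1}" by (auto simp: f_def)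
      ultimately show False using inf[of f] by (meson finite.emptyI finite.insertI inj_on_finite)
    qed
    then obtain n where "X f \<subseteq> f -` {n}" using ramsey by blast
    then have n: "f x = n" if "x \<in> X f" for x using that by blast
    have "X f \<subseteq> A \<or> X f \<subseteq> - A"
    proof (cases "n = 1")
      case True
      have "x \<in> A" if "x \<in> X f" for x
        by (rule ccontr) (use n[OF that] True in \<open>simp add: f_def\<close>)
      then show ?thesis by blast
    next
      case False
      have "x \<notin> A" if "x \<in> X f" for x
        by (rule ccontr) (use n[OF that] False in \<open>simp add: f_def\<close>)
      then show ?thesis by blast
    qed
    then show ?thesis using sup[OF XU] by blast
  qed
  have U: "is_ultrafilter U"
    unfolding is_ultrafilter_def
  proof (intro conjI ballI allI impI)
    fix A B assume "A \<in> U" "B \<in> U"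
    then obtain f g where fg: "finite (X f - A)" "finite (X g - B)" by (auto simp: U_def)
    from chain[of f g] show "A \<inter> B \<in> U"
    proof
      assume "finite (X f - X g)"
      then have "finite ((X f - A) \<union> (X g - B) \<union> (X f - X g))" using fg by blast
      then have "finite (X f - A \<inter> B)" by (rule finite_subset[rotated]) blast
      then show ?thesis by (rule UI)
    next
      assume "finite (X g - X f)"
      then have "finite ((X f - A) \<union> (X g - B) \<union> (X g - X f))" using fg by blast
      then have "finite (X g - A \<inter> B)" by (rule finite_subset[rotated]) blast
      then show ?thesis by (rule UI)
    qed
  next
    fix A :: "nat set" assume "finite (- A)"
    then show "A \<in> U" by (intro UI) (auto intro: finite_subset[rotated])
  next
    show "{} \<notin> U" using inf by (simp add: U_def)
  qed (use sup split in blast)+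
  have "selective_ultrafilter U"
    by (rule selective_ultrafilterI[OF U], rule bexI, rule ramsey, rule XU)
  moreover have "K \<subseteq> dual_ideal U"
  proof
    fix A assume "A \<in> K"
    have "A \<notin> U"
    proof
      assume "A \<in> U"
      then obtain f where "finite (X f - A)" by (auto simp: U_def)
      then have "X f \<inter> A \<in> positive K" using positive_almost_subset[OF id pos] by blast
      then show False using \<open>A \<in> K\<close> ideal_subset[OF id, of A "X f \<inter> A"] by (auto simp: positive_def)
    qed
    then show "A \<in> dual_ideal U" using ultrafilter_Compl_iff[OF U] by (simp add: dual_ideal_iff)
  qed
  ultimately show thesis by (rule that)
qed

section \<open>Extendability to a selective ideal\<close>

theorem theorem9p3:
  fixes J :: "nat set set"
  assumes "is_ideal J"
  shows
    "(extendable_to_selective J \<longleftrightarrow> \<not> preceq_omega1 all_functions one_to_one ED J) \<and>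
     (extendable_to_selective J \<longleftrightarrow> \<not> preceq_omega1 all_functions finite_to_one ED J) \<and>
     (extendable_to_selective J \<longleftrightarrow> \<not> preceq_omega1 all_functions all_functions ED J) \<and>
     (CH \<longrightarrow>
       (extendable_to_selective J \<longleftrightarrow> (\<exists>U. selective_ultrafilter U \<and> \<not> J_point J U)) \<and>
       (extendable_to_selective J \<longleftrightarrow> (\<exists>U. selective_ultrafilter U \<and> \<not> weak_J_ultrafilter J U)) \<and>
       (extendable_to_selective J \<longleftrightarrow> (\<exists>U. selective_ultrafilter U \<and> \<not> J_ultrafilter J U)))"
proof -
  have all: "le_via all_functions J K" if "le_via G J K" for G K
    using le_via_mono[OF _ that] by (simp add: all_functions_def)
  have ideal: "extendable_to_selective J \<longleftrightarrow> (\<exists>K. selective_ideal K \<and> le_via G J K)"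
    if G: "one_to_one \<subseteq> G" for G
    using extendable_if_le_selective[OF assms] all le_via_mono[OF G] le_via_one_to_one_if_subset
    unfolding extendable_to_selective_def by metis
  have ultra: "extendable_to_selective J \<longleftrightarrow>
      (\<exists>U. selective_ultrafilter U \<and> \<not> (is_ultrafilter U \<and> \<not> le_via G J (dual_ideal U)))"
    if CH and G: "one_to_one \<subseteq> G" for G
  proof
    assume "extendable_to_selective J"
    then obtain K where K: "selective_ideal K" "J \<subseteq> K"
      unfolding extendable_to_selective_def by blast
    obtain U where U: "selective_ultrafilter U" "K \<subseteq> dual_ideal U"
      using CH_selective_ultrafilter[OF \<open>CH\<close> K(1)] .
    have "le_via G J (dual_ideal U)"
      by (rule le_via_mono[OF G], rule le_via_one_to_one_if_subset) (use K(2) U(2) in blast)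
    then show
      "\<exists>U. selective_ultrafilter U \<and> \<not> (is_ultrafilter U \<and> \<not> le_via G J (dual_ideal U))"
      using U(1) by blast
  next
    assume "\<exists>U. selective_ultrafilter U \<and> \<not> (is_ultrafilter U \<and> \<not> le_via G J (dual_ideal U))"
    then show "extendable_to_selective J"
      using ideal[OF G] unfolding selective_ultrafilter_def by blast
  qed
  have sub: "one_to_one \<subseteq> all_functions" by (simp add: all_functions_def)
  show ?thesis
    unfolding not_preceq_ED_iff J_point_def weak_J_ultrafilter_def J_ultrafilter_def
    using ideal[OF order_refl] ideal[OF one_to_one_subset] ideal[OF sub]
      ultra[OF _ order_refl] ultra[OF _ one_to_one_subset] ultra[OF _ sub] by blast
qed

end
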